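(* Let $\mathbf{Z}$ be a non-empty measurable space whose $\sigma$-algebra is different from $\{\emptyset,\mathbf{Z}\}$. For any $\epsilon>0$ and any $c>1$, there exist an exchangeable probability measure $P$ on $\mathbf{Z}^\infty$ and a conformal e-pseudomartingale $(S_n)_{n\ge0}$ such that \[ P(S^*_\infty\ge c)\ge 1-\epsilon,\qquad\text{where } S^*_\infty:=\sup_{n=1,2,\dots}S_n. \]
   Context: For a set $X$, $X^+:=\bigcup_{n=1}^\infty X^n$ is the set of non-empty finite sequences of elements of $X$ (a measurable space if $X$ is). A nonconformity e-measure is a measurable function $A:\mathbf{Z}^+\to[0,\infty)^+$ mapping every finite sequence $(z_1,\dots,z_m)$, $m\ge1$, to a sequence $(\alpha_1,\dots,\alpha_m)$ of the same length such that (i) $\frac1m\sum_{i=1}^m\alpha_i\le1$, and (ii) (equivariance) for any $m$ and any permutation $\pi$ of $\{1,\dots,m\}$, if $(\alpha_1,\dots,\alpha_m)=A(z_1,\dots,z_m)$ then $(\alpha_{\pi(1)},\dots,\alpha_{\pi(m)})=A(z_{\pi(1)},\dots,z_{\pi(m)})$. The corresponding conformal e-predictor is $f:\mathbf{Z}^+\to[0,\infty)$, $f(z_1,\dots,z_m):=\alpha_m$ where $(\alpha_1,\dots,\alpha_m)=A(z_1,\dots,z_m)$. Given a conformal e-predictor $f$, and writing $Z_1,Z_2,\dots$ for the coordinate random elements on $\mathbf{Z}^\infty$, the conformal e-variables are $E_n:=f(Z_1,\dots,Z_n)$, and the corresponding conformal e-pseudomartingale is $S_n:=E_1\cdots E_n$,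 $n=0,1,2,\dots$, with $S_0:=1$. A probability measure $P$ on $\mathbf{Z}^\infty$ is exchangeable if, under $P$, for every $n$ the joint distribution of $(Z_1,\dots,Z_n)$ is invariant under permutations. *)

theory Defs
  imports "HOL-Probability.Probability" "HOL-Combinatorics.Permutations"
begin

text \<open>The set \<open>X\<^sup>+\<close> of non-empty finite sequences, encoded as lists, with the
  \<open>\<sigma>\<close>-algebra of the disjoint union of the powers \<open>X\<^sup>n\<close>, \<open>n \<ge> 1\<close>: a set is measurable iff its
  part in every \<open>X\<^sup>n\<close> is measurable for the product \<open>\<sigma>\<close>-algebra. Only the \<open>\<sigma>\<close>-algebra
  matters; the measure is the zero measure.\<close>

definition plus_sets :: "'a measure \<Rightarrow> 'a list set set" where
  "plus_sets M = {B. B \<subseteq> lists (space M) - {[]} \<and>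
     (\<forall>n\<ge>1. {x \<in> space (\<Pi>\<^sub>M i\<in>{..<n}. M). map x [0..<n] \<in> B} \<in> sets (\<Pi>\<^sub>M i\<in>{..<n}. M))}"

definition plus_space :: "'a measure \<Rightarrow> 'a list measure" where
  "plus_space M = sigma (lists (space M) - {[]}) (plus_sets M)"

lemma sigma_algebra_plus_sets: "sigma_algebra (lists (space M) - {[]}) (plus_sets M)"
proof -
  define L where "L = lists (space M) - {[]}"
  define P where "P n = (\<Pi>\<^sub>M i\<in>{..<n}. M)" for n :: nat
  define pre where "pre n B = {x \<in> space (P n). map x [0..<n] \<in> B}" for n B
  have plus_sets_iff: "B \<in> plus_sets M \<longleftrightarrow> B \<subseteq> L \<and> (\<forall>n\<ge>1. pre n B \<in> sets (P n))" for B
    unfolding plus_sets_def L_def P_def pre_def by (rule mem_Collect_eq)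
  have map_in_L: "map x [0..<n] \<in> L" if "x \<in> space (P n)" "n \<ge> 1" for x n
    using that unfolding P_def L_def space_PiM by (simp add: in_lists_conv_set PiE_iff)
  have compl: "pre n (L - B) = space (P n) - pre n B" if "n \<ge> 1" for n B
    using map_in_L[OF _ that] unfolding pre_def by blast
  have union: "pre n (\<Union>k. B k) = (\<Union>k. pre n (B k))" for n and B :: "nat \<Rightarrow> 'a list set"
    unfolding pre_def by blast
  have "L - B \<in> plus_sets M" if "B \<in> plus_sets M" for B
    using that compl unfolding plus_sets_iff by (simp add: sets.Diff)
  moreover have "(\<Union>k. B k) \<in> plus_sets M" if "range B \<subseteq> plus_sets M" for B :: "nat \<Rightarrow> 'a list set"
  proof -
    have B: "B k \<subseteq> L" "\<And>n. n \<ge> 1 \<Longrightarrow> pre n (B k) \<in> sets (P n)" for k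
      using that plus_sets_iff[of "B k"] by (simp_all add: image_subset_iff)
    have "pre n (\<Union>k. B k) \<in> sets (P n)" if "n \<ge> 1" for n
      unfolding union by (rule sets.countable_UN) (simp add: image_subset_iff B(2)[OF that])
    then show ?thesis
      unfolding plus_sets_iff using B(1) by (simp add: UN_least)
  qed
  moreover have "{} \<in> plus_sets M"
    unfolding plus_sets_iff pre_def by simp
  moreover have "plus_sets M \<subseteq> Pow L"
    using plus_sets_iff by (simp add: subset_iff)
  ultimately show ?thesis
    unfolding L_def[symmetric] sigma_algebra_iff2 by simp
qed

lemma space_plus_space: "space (plus_space M) = lists (space M) - {[]}"
  unfolding plus_space_def
  by (rule space_measure_of) (simp add: plus_sets_def Collect_mono Pow_def)

lemma sets_plus_space: "sets (plus_space M) = plus_sets M"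
  unfolding plus_space_def by (rule sigma_algebra.sets_measure_of_eq[OF sigma_algebra_plus_sets])

definition nonconformity_e_measure :: "'a measure \<Rightarrow> ('a list \<Rightarrow> real list) \<Rightarrow> bool" where
  "nonconformity_e_measure M A \<longleftrightarrow>
     A \<in> plus_space M \<rightarrow>\<^sub>M plus_space (restrict_space borel {0..}) \<and>
     (\<forall>zs \<in> space (plus_space M).
        length (A zs) = length zs \<and>
        1 / real (length zs) * (\<Sum>i<length zs. A zs ! i) \<le> 1 \<and>
        (\<forall>\<pi>. \<pi> permutes {..<length zs} \<longrightarrow> A (permute_list \<pi> zs) = permute_list \<pi> (A zs)))"

definition conformal_e_predictor :: "'a measure \<Rightarrow> ('a list \<Rightarrow> real) \<Rightarrow> bool" where
  "conformal_e_predictor M f \<longleftrightarrow>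
     (\<exists>A. nonconformity_e_measure M A \<and> (\<forall>zs \<in> space (plus_space M). f zs = last (A zs)))"

text \<open>A point of \<open>Z\<^sup>\<infinity>\<close> is a function \<open>\<omega> :: nat \<Rightarrow> 'a\<close>, and the coordinates are numbered from zero:
  \<open>Z\<^sub>n\<close> is \<open>\<omega> (n - 1)\<close>, for \<open>n \<ge> 1\<close>.\<close>

definition conformal_e_variable :: "('a list \<Rightarrow> real) \<Rightarrow> nat \<Rightarrow> (nat \<Rightarrow> 'a) \<Rightarrow> real" where
  "conformal_e_variable f n \<omega> = f (map \<omega> [0..<n])"

definition conformal_e_pseudomartingale :: "'a measure \<Rightarrow> (nat \<Rightarrow> (nat \<Rightarrow> 'a) \<Rightarrow> real) \<Rightarrow> bool" where
  "conformal_e_pseudomartingale M S \<longleftrightarrow>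
     (\<exists>f. conformal_e_predictor M f \<and>
       (\<forall>n. \<forall>\<omega> \<in> space (\<Pi>\<^sub>M i\<in>UNIV. M). S n \<omega> = (\<Prod>k=1..n. conformal_e_variable f k \<omega>)))"

definition exchangeable :: "'a measure \<Rightarrow> (nat \<Rightarrow> 'a) measure \<Rightarrow> bool" where
  "exchangeable M P \<longleftrightarrow>
     (\<forall>n \<pi>. \<pi> permutes {..<n} \<longrightarrow>
        distr P (\<Pi>\<^sub>M i\<in>{..<n}. M) (\<lambda>\<omega>. \<lambda>i\<in>{..<n}. \<omega> (\<pi> i)) =
        distr P (\<Pi>\<^sub>M i\<in>{..<n}. M) (\<lambda>\<omega>. \<lambda>i\<in>{..<n}. \<omega> i))"

end

theory Submission imports Defs begin

text \<open>Fix a measurable set \<open>U\<close> that is neither empty nor the whole space. The nonconformity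
  e-measure shares the total score \<open>m\<close> equally among those of \<open>z\<^sub>1, \<dots>, z\<^sub>m\<close> that lie in \<open>U\<close>
  (and gives everyone the score 1 if there are none). Along a sequence that first visits \<open>U\<close>
  at time \<open>T\<close> the product is therefore constantly 1 before \<open>T\<close> and jumps to \<open>T\<close> at time \<open>T\<close>.
  If the observations are independent and hit \<open>U\<close> with a very small positive probability, then
  \<open>T\<close> is finite and larger than \<open>c\<close> with probability close to 1.\<close>

section \<open>The score-sharing nonconformity e-measure\<close>

definition count_in :: "'a set \<Rightarrow> 'a list \<Rightarrow> real" where
  "count_in U zs = sum_list (map (indicator U) zs)"

definition share_score :: "'a set \<Rightarrow> 'a list \<Rightarrow> 'a \<Rightarrow> real" where
  "share_score U zs z =
     (if count_in U zs = 0 then 1 else real (length zs) * indicator U z / count_in U zs)"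

definition share_measure :: "'a set \<Rightarrow> 'a list \<Rightarrow> real list" where
  "share_measure U zs = map (share_score U zs) zs"

lemma count_in_nonneg: "count_in U zs \<ge> 0"
  unfolding count_in_def by (rule sum_list_nonneg) auto

lemma share_score_nonneg: "share_score U zs z \<ge> 0"
  unfolding share_score_def by (simp add: count_in_nonneg)

lemma count_in_map_upt: "count_in U (map x [0..<n]) = (\<Sum>i<n. indicator U (x i))"
  unfolding count_in_def
  by (simp add: comp_def interv_sum_list_conv_sum_set_nat atLeast0LessThan)

lemma length_share_measure: "length (share_measure U zs) = length zs"
  by (simp add: share_measure_def)

text \<open>The bound 1 on the average score is attained: with no visit to \<open>U\<close> each
  entry scores 1, and otherwise the entries in \<open>U\<close> receive equal shares that add up to
  the length.\<close>

lemma sum_share_measure: "(\<Sum>i<length zs. share_measure U zs ! i) = real (length zs)"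
proof -
  have "(\<Sum>i<length zs. share_measure U zs ! i) = sum_list (map (share_score U zs) zs)"
    by (simp add: share_measure_def sum_list_sum_nth atLeast0LessThan)
  also have "\<dots> = real (length zs)"
  proof (cases "count_in U zs = 0")
    case True
    then show ?thesis
      by (simp add: share_score_def[abs_def] sum_list_triv)
  next
    case False
    have "sum_list (map (share_score U zs) zs)
        = (real (length zs) / count_in U zs) * count_in U zs"
      unfolding share_score_def using False
      by (simp add: count_in_def sum_list_const_mult[symmetric])
    with False show ?thesis
      by simp
  qed
  finally show ?thesis .
qed

text \<open>The scoring function depends on the list only through its length and the number of
  entries in \<open>U\<close>; both survive a permutation, so each entry carries its score
  along.\<close>

lemma share_measure_permute:
  assumes "\<pi> permutes {..<length zs}"
  shows "share_measure U (permute_list \<pi> zs) = permute_list \<pi> (share_measure U zs)"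
proof -
  have "count_in U (permute_list \<pi> zs) = count_in U zs"
    unfolding count_in_def
    by (metis assms mset_map mset_permute_list sum_mset_sum_list)
  then have "share_score U (permute_list \<pi> zs) = share_score U zs"
    by (intro ext) (simp add: share_score_def)
  with assms show ?thesis
    by (simp add: share_measure_def permute_list_map)
qed

text \<open>The index set \<open>I\<close> is left general because two products occur:
  \<open>{..<n}\<close> for measurability of the e-measure, and \<open>UNIV\<close> for
  measurability of the pseudomartingale.\<close>

lemma share_score_measurable:
  assumes U: "U \<in> sets M" and I: "{..<n} \<subseteq> I" and i: "i < n"
  shows "(\<lambda>x. share_score U (map x [0..<n]) (x i)) \<in> borel_measurable (\<Pi>\<^sub>M i\<in>I. M)"
proof -
  have coord: "(\<lambda>x. indicator U (x j) :: real) \<in> borel_measurable (\<Pi>\<^sub>M i\<in>I. M)"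
    if "j < n" for j
    using that U I
    by (intro measurable_compose[OF measurable_component_singleton borel_measurable_indicator]) auto
  have [measurable]: "(\<lambda>x. indicator U (x i) :: real) \<in> borel_measurable (\<Pi>\<^sub>M i\<in>I. M)"
    "(\<lambda>x. \<Sum>j<n. indicator U (x j) :: real) \<in> borel_measurable (\<Pi>\<^sub>M i\<in>I. M)"
    using coord i by (auto intro: borel_measurable_sum)
  show ?thesis
    unfolding share_score_def count_in_map_upt length_map length_upt by measurable
qed

text \<open>Measurability is tested separately on each length. Lengths are preserved, so on lists of
  length \<open>n\<close> the map is a function \<open>h\<close> between \<open>n\<close>-fold
  products, measurable in each coordinate.\<close>

lemma share_measure_measurable:
  assumes U: "U \<in> sets M"
  shows "share_measure U \<in> plus_space M \<rightarrow>\<^sub>M plus_space (restrict_space borel {0..})"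
proof (rule measurableI)
  fix zs assume "zs \<in> space (plus_space M)"
  then show "share_measure U zs \<in> space (plus_space (restrict_space borel {0..}))"
    by (auto simp: space_plus_space share_measure_def share_score_nonneg in_lists_conv_set)
next
  fix B assume "B \<in> sets (plus_space (restrict_space (borel :: real measure) {0..}))"
  then have B: "{y \<in> space (\<Pi>\<^sub>M i\<in>{..<n}. restrict_space borel {0..}). map y [0..<n] \<in> B}
      \<in> sets (\<Pi>\<^sub>M i\<in>{..<n}. restrict_space borel {0..})" if "n \<ge> 1" for n
    using that by (auto simp: sets_plus_space plus_sets_def)
  have "{x \<in> space (\<Pi>\<^sub>M i\<in>{..<n}. M).
      map x [0..<n] \<in> share_measure U -` B \<inter> space (plus_space M)}
      \<in> sets (\<Pi>\<^sub>M i\<in>{..<n}. M)" if n: "n \<ge> 1" for n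
  proof -
    define h where "h x = (\<lambda>i\<in>{..<n}. share_score U (map x [0..<n]) (x i))" for x
    have h: "h \<in> (\<Pi>\<^sub>M i\<in>{..<n}. M) \<rightarrow>\<^sub>M (\<Pi>\<^sub>M i\<in>{..<n}. restrict_space borel {0..})"
      unfolding h_def
      by (intro measurable_restrict measurable_restrict_space2)
        (auto simp: share_score_nonneg share_score_measurable[OF U])
    have "share_measure U (map x [0..<n]) = map (h x) [0..<n]" for x
      by (simp add: share_measure_def h_def)
    moreover have "map x [0..<n] \<in> space (plus_space M)" if "x \<in> space (\<Pi>\<^sub>M i\<in>{..<n}. M)" for x
      using that n by (auto simp: space_plus_space space_PiM in_lists_conv_set PiE_iff)
    ultimately have "{x \<in> space (\<Pi>\<^sub>M i\<in>{..<n}. M).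
        map x [0..<n] \<in> share_measure U -` B \<inter> space (plus_space M)}
      = h -` {y \<in> space (\<Pi>\<^sub>M i\<in>{..<n}. restrict_space borel {0..}). map y [0..<n] \<in> B}
          \<inter> space (\<Pi>\<^sub>M i\<in>{..<n}. M)"
      using measurable_space[OF h] by auto
    with measurable_sets[OF h B[OF n]] show ?thesis
      by simp
  qed
  then show "share_measure U -` B \<inter> space (plus_space M) \<in> sets (plus_space M)"
    unfolding sets_plus_space plus_sets_def by (auto simp: space_plus_space)
qed

lemma nonconformity_e_measure_share_measure:
  assumes "U \<in> sets M"
  shows "nonconformity_e_measure M (share_measure U)"
  unfolding nonconformity_e_measure_def
  using share_measure_measurable[OF assms] share_measure_permute[of _ _ U]
  by (auto simp: sum_share_measure length_share_measure)

text \<open>Prefixes that avoid \<open>U\<close> contribute factors 1. The prefix ending in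
  \<open>\<omega> t\<close> has a single entry in \<open>U\<close>, its last, which collects the
  whole total \<open>Suc t\<close>. Coordinates start at zero, so index \<open>t\<close> is time
  \<open>Suc t\<close>.\<close>

lemma prod_last_share_measure_first_visit:
  assumes "\<omega> t \<in> U" and before: "\<And>i. i < t \<Longrightarrow> \<omega> i \<notin> U"
  shows "(\<Prod>k=1..Suc t. conformal_e_variable (last \<circ> share_measure U) k \<omega>) = real (Suc t)"
proof -
  have last: "conformal_e_variable (last \<circ> share_measure U) (Suc k) \<omega>
      = share_score U (map \<omega> [0..<Suc k]) (\<omega> k)" for k
    by (simp add: conformal_e_variable_def share_measure_def)
  have zero: "(\<Sum>i<k. indicator U (\<omega> i)) = (0 :: real)" if "k \<le> t" for k
    using that before by (intro sum.neutral) auto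
  have "conformal_e_variable (last \<circ> share_measure U) k \<omega> = 1" if "k \<in> {1..t}" for k
  proof (cases k)
    case (Suc j)
    with that zero[of k] show ?thesis
      unfolding Suc last share_score_def count_in_map_upt by simp
  qed (use that in simp)
  moreover have "conformal_e_variable (last \<circ> share_measure U) (Suc t) \<omega> = real (Suc t)"
    unfolding last share_score_def count_in_map_upt using zero[of t] assms(1) by simp
  ultimately show ?thesis
    by simp
qed

section \<open>Independent identically distributed observations\<close>

text \<open>Any \<open>n\<close> distinct coordinates of an i.i.d. sequence have the
  \<open>n\<close>-fold product law, so both sides of the exchangeability equation equal it.\<close>

lemma exchangeable_iid:
  assumes "prob_space D" and sets: "sets D = sets M"
  shows "exchangeable M (\<Pi>\<^sub>M i\<in>UNIV. D)"
proof -
  have "distr (\<Pi>\<^sub>M i\<in>UNIV. D) (\<Pi>\<^sub>M i\<in>{..<n}. M) (\<lambda>\<omega>. \<lambda>i\<in>{..<n}. \<omega> (\<pi> i)) = (\<Pi>\<^sub>M i\<in>{..<n}. D)"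
    if "inj_on \<pi> {..<n}" for n :: nat and \<pi> :: "nat \<Rightarrow> nat"
  proof -
    have "distr (\<Pi>\<^sub>M i\<in>UNIV. D) (\<Pi>\<^sub>M i\<in>{..<n}. D) (\<lambda>\<omega>. \<lambda>i\<in>{..<n}. \<omega> (\<pi> i)) = (\<Pi>\<^sub>M i\<in>{..<n}. D)"
      by (rule distr_PiM_reindex) (use assms that in auto)
    moreover have "sets (\<Pi>\<^sub>M i\<in>{..<n}. D) = sets (\<Pi>\<^sub>M i\<in>{..<n}. M)"
      by (rule sets_PiM_cong) (simp_all add: sets)
    ultimately show ?thesis
      by (metis distr_cong)
  qed
  from this[OF permutes_inj_on] this[of "\<lambda>i. i"] show ?thesis
    unfolding exchangeable_def by simp
qed

text \<open>Singletons may fail to be measurable in \<open>M\<close>, so the law on two points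
  \<open>a\<close>, \<open>b\<close>, separated by \<open>U\<close>, is built as the image of a
  Bernoulli law.\<close>

lemma two_point_distribution:
  assumes "U \<in> sets M" "U \<noteq> {}" "U \<noteq> space M" "0 \<le> p" "p \<le> 1"
  obtains D where "prob_space D" "sets D = sets M" "measure D (space M - U) = 1 - p"
proof -
  obtain a b where ab: "a \<in> U" "b \<in> space M - U"
    using assms sets.sets_into_space by fast
  then have a: "a \<in> space M"
    using assms sets.sets_into_space by fast
  define g where "g x = (if x then a else b)" for x
  define D where "D = distr (measure_pmf (bernoulli_pmf p)) M g"
  have g: "g \<in> measure_pmf (bernoulli_pmf p) \<rightarrow>\<^sub>M M"
    using ab a by (auto simp: g_def)
  have "g -` (space M - U) = {False}"
    using ab by (auto simp: g_def)
  with assms g have "measure D (space M - U) = 1 - p"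
    by (simp add: D_def measure_distr measure_pmf_single)
  moreover have "prob_space D"
    unfolding D_def by (rule prob_space.prob_space_distr[OF prob_space_measure_pmf g])
  ultimately show ?thesis
    using that[of D] by (simp add: D_def)
qed

lemma measure_iid_prefix:
  fixes n :: nat
  assumes "prob_space D" and "X \<in> sets D"
  shows "measure (\<Pi>\<^sub>M i\<in>UNIV. D) {\<omega> \<in> space (\<Pi>\<^sub>M i\<in>UNIV. D). \<forall>i<n. \<omega> i \<in> X} = measure D X ^ n"
proof -
  interpret D: prob_space D by fact
  interpret product_prob_space "\<lambda>_. D" "UNIV :: nat set" ..
  have "{\<omega> \<in> space (\<Pi>\<^sub>M i\<in>UNIV. D). \<forall>i<n. \<omega> i \<in> X}
      = prod_emb UNIV (\<lambda>_. D) {..<n} (\<Pi>\<^sub>E i\<in>{..<n}. X)"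
    by (auto simp: prod_emb_def space_PiM restrict_PiE_iff)
  then show ?thesis
    using assms by (simp add: measure_PiM_emb)
qed

section \<open>Choice of parameters and probability of a late first visit\<close>

theorem proposition2:
  fixes M :: "'a measure" and \<epsilon> c :: real
  assumes "space M \<noteq> {}"
    and "sets M \<noteq> {{}, space M}"
    and "\<epsilon> > 0"
    and "c > 1"
  shows "\<exists>(P :: (nat \<Rightarrow> 'a) measure) S.
    prob_space P \<and> sets P = sets (\<Pi>\<^sub>M i\<in>UNIV. M) \<and> exchangeable M P \<and>
    conformal_e_pseudomartingale M S \<and>
    measure P {\<omega> \<in> space P. (SUP n\<in>{1..}. ereal (S n \<omega>)) \<ge> ereal c} \<ge> 1 - \<epsilon>"
proof -
  obtain U where U: "U \<in> sets M" "U \<noteq> {}" "U \<noteq> space M"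
    using assms(2) sets.top[of M] sets.empty_sets[of M] by blast
  define N where "N = nat \<lceil>c\<rceil>"
  have N: "c \<le> real N"
    unfolding N_def by linarith
  with \<open>c > 1\<close> have "N > 0"
    by (cases N) auto
  \<comment> \<open>By Bernoulli's inequality, \<open>N * p \<le> \<epsilon> / 2\<close> makes a
    visit among the first \<open>N\<close> observations have probability at most
    \<open>\<epsilon> / 2\<close>. The cap \<open>1/2\<close> keeps \<open>p\<close> a probability
    when \<epsilon> is large.\<close>
  define p where "p = min (1/2) (\<epsilon> / 2 / real N)"
  have p: "0 < p" "p \<le> 1/2" "p \<le> \<epsilon> / 2 / real N"
    using \<open>\<epsilon> > 0\<close> \<open>N > 0\<close> by (auto simp: p_def)
  then have Np: "real N * p \<le> \<epsilon> / 2"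
    using \<open>N > 0\<close> by (simp add: field_simps)
  have late: "(1 - p) ^ N \<ge> 1 - \<epsilon> / 2"
    using Bernoulli_inequality[of "- p" N] p Np by simp
  \<comment> \<open>With \<open>p\<close> fixed and positive, a long enough horizon \<open>K\<close>
    makes it unlikely that \<open>U\<close> is avoided throughout.\<close>
  obtain K where K: "(1 - p) ^ K < \<epsilon> / 2"
    using real_arch_pow_inv[of "\<epsilon> / 2" "1 - p"] p \<open>\<epsilon> > 0\<close> by auto
  obtain D where D: "prob_space D" and sets_D: "sets D = sets M"
    and D_U: "measure D (space M - U) = 1 - p"
    using two_point_distribution[OF U, of p] p by auto
  have space_D: "space D = space M"
    using sets_D by (rule sets_eq_imp_space_eq)
  define P where "P = (\<Pi>\<^sub>M i\<in>(UNIV :: nat set). D)"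
  define f where "f = last \<circ> share_measure U"
  define S where "S n \<omega> = (\<Prod>k=1..n. conformal_e_variable f k \<omega>)" for n \<omega>
  have sets_P: "sets P = sets (\<Pi>\<^sub>M i\<in>UNIV. M)"
    unfolding P_def by (rule sets_PiM_cong) (simp_all add: sets_D)
  interpret P: prob_space P
    unfolding P_def by (rule prob_space_PiM) (rule D)
  have [measurable]: "U \<in> sets D"
    using U sets_D by simp
  have "conformal_e_predictor M f"
    unfolding conformal_e_predictor_def f_def
    using nonconformity_e_measure_share_measure[OF U(1)] by auto
  then have "conformal_e_pseudomartingale M S"
    unfolding conformal_e_pseudomartingale_def S_def by blast
  have "(\<lambda>\<omega>. conformal_e_variable f (Suc j) \<omega>) \<in> borel_measurable P" for j
  proof -
    have "(\<lambda>\<omega>. share_score U (map \<omega> [0..<Suc j]) (\<omega> j)) \<in> borel_measurable P"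
      unfolding P_def by (rule share_score_measurable) auto
    then show ?thesis
      by (simp add: conformal_e_variable_def f_def share_measure_def)
  qed
  then have "S n \<in> borel_measurable P" for n
    unfolding S_def
    by (intro borel_measurable_prod) (metis Suc_le_D One_nat_def atLeastAtMost_iff)
  \<comment> \<open>The event in the conclusion must be measurable for the monotonicity of
    \<open>measure P\<close> to apply to it below.\<close>
  then have [measurable]: "(\<lambda>\<omega>. SUP n\<in>{1..}. ereal (S n \<omega>)) \<in> borel_measurable P"
    by (intro borel_measurable_SUP) auto
  define A where "A n = {\<omega> \<in> space P. \<forall>i<n. \<omega> i \<in> space M - U}" for n
  have A: "measure P (A n) = (1 - p) ^ n" for n
    unfolding A_def P_def
    using measure_iid_prefix[OF D, of "space M - U" n] U sets_D D_U by simp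
  have [measurable]: "A n \<in> sets P" for n
    unfolding A_def P_def space_D[symmetric] by measurable
  \<comment> \<open>On this event \<open>U\<close> is visited among the first \<open>K\<close>
    observations but not among the first \<open>N\<close>. The first visit thus has index
    \<open>t \<ge> N\<close>, and the product reaches \<open>Suc t\<close>, which exceeds
    \<open>c\<close>.\<close>
  have "A N - A K \<subseteq> {\<omega> \<in> space P. (SUP n\<in>{1..}. ereal (S n \<omega>)) \<ge> ereal c}"
  proof
    fix \<omega> assume \<omega>: "\<omega> \<in> A N - A K"
    then have "\<omega> \<in> space P"
      by (simp add: A_def)
    then have "\<omega> i \<in> space M" for i
      by (auto simp: P_def space_PiM space_D)
    with \<omega> obtain i where "\<omega> i \<in> U"
      by (auto simp: A_def)
    define t where "t = (LEAST i. \<omega> i \<in> U)"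
    have t: "\<omega> t \<in> U" "\<And>i. i < t \<Longrightarrow> \<omega> i \<notin> U"
      unfolding t_def using \<open>\<omega> i \<in> U\<close> by (rule LeastI) (rule not_less_Least)
    have "t \<ge> N"
      using \<omega> t(1) by (metis (no_types, lifting) A_def DiffD1 DiffD2 mem_Collect_eq not_le)
    moreover have "S (Suc t) \<omega> = real (Suc t)"
      unfolding S_def f_def using t by (rule prod_last_share_measure_first_visit)
    ultimately have "ereal c \<le> ereal (S (Suc t) \<omega>)"
      using N by simp
    also have "\<dots> \<le> (SUP n\<in>{1..}. ereal (S n \<omega>))"
      by (rule SUP_upper) simp
    finally show "\<omega> \<in> {\<omega> \<in> space P. (SUP n\<in>{1..}. ereal (S n \<omega>)) \<ge> ereal c}"
      using \<open>\<omega> \<in> space P\<close> by simp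
  qed
  then have "measure P (A N - A K)
      \<le> measure P {\<omega> \<in> space P. (SUP n\<in>{1..}. ereal (S n \<omega>)) \<ge> ereal c}"
    by (rule P.finite_measure_mono) measurable
  \<comment> \<open>Subadditivity bounds the probability of \<open>A N - A K\<close> below by
    \<open>(1 - \<epsilon> / 2) - \<epsilon> / 2\<close>.\<close>
  moreover have "measure P (A N) \<le> measure P (A N - A K) + measure P (A K)"
    by (rule order_trans[OF P.finite_measure_mono measure_Un_le]) auto
  ultimately have "measure P {\<omega> \<in> space P. (SUP n\<in>{1..}. ereal (S n \<omega>)) \<ge> ereal c} \<ge> 1 - \<epsilon>"
    using late K A[of N] A[of K] by linarith
  moreover have "exchangeable M P"
    unfolding P_def by (rule exchangeable_iid[OF D sets_D])
  ultimately show ?thesis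
    using P.prob_space_axioms sets_P \<open>conformal_e_pseudomartingale M S\<close> by blast
qed

end
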